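(* Let $\mathbb{A}$ be a finite non-empty set and let $\preceq$ be a total order on $\mathbb{A}^{\mathbb{N}}$ such that for each $n\in\mathbb{N}$ and all $u,v\in\mathbb{A}^n$, if $u^\omega\prec v^\omega$ then $ux\prec vy$ for all $x,y\in\mathbb{A}^{\mathbb{N}}$. Then each infinite word $x\in\mathbb{A}^{\mathbb{N}}$ admits precisely one $\omega$-Lyndon factorisation (finite or infinite): exactly one factorisation of $x$ exists among all its finite $\omega$-Lyndon factorisations and infinite $\omega$-Lyndon factorisations taken together.
   Context: $\mathbb{N}=\{1,2,3,\ldots\}$; $\mathbb{A}^+=\bigcup_{n\in\mathbb{N}}\mathbb{A}^n$ is the set of non-empty finite words over $\mathbb{A}$, and $\mathbb{A}^{\mathbb{N}}$ is the set of right infinite words. For $w\in\mathbb{A}^+$, $w^\omega=www\cdots\in\mathbb{A}^{\mathbb{N}}$. $x\prec y$ means $x\preceq y$ and $x\ne y$. A proper suffix of a finite word $w$ is a word $v\in\mathbb{A}^+$ with $w=uv$ for some $u\in\mathbb{A}^+$; a proper suffix of an infinite word $x$ is a $y\in\mathbb{A}^{\mathbb{N}}$ with $x=uy$ for some $u\in\mathbb{A}^+$ (so $y=x$ is possible when $x$ is periodic). An infinite word $x\in\mathbb{A}^{\mathbb{N}}$ is $\omega$-Lyndon if $x\prec y$ for each proper suffix $y$ of $x$. A finite word $w\in\mathbb{A}^+$ is $\omega$-Lyndon if $w^\omega\prec v^\omega$ for each proper suffix $v$ of $w$. $\mathcal{L}_\omega$ denotes the set of all finite and infinite $\omega$-Lyndon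 words. An infinite $\omega$-Lyndon factorisation of $x\in\mathbb{A}^{\mathbb{N}}$ is a factorisation $x=l_1l_2l_3\cdots$ with each $l_i\in\mathcal{L}_\omega\cap\mathbb{A}^+$ and $l_1^\omega\succeq l_2^\omega\succeq l_3^\omega\succeq\cdots$. A finite $\omega$-Lyndon factorisation of $x$ is a factorisation $x=l_1l_2\cdots l_k$ with $k\ge1$, all $l_i\in\mathcal{L}_\omega$, $l_1,\ldots,l_{k-1}\in\mathbb{A}^+$, $l_k\in\mathbb{A}^{\mathbb{N}}$, and $l_1^\omega\succeq l_2^\omega\succeq\cdots\succeq l_{k-1}^\omega\succ l_k$ (for $k=1$ this just says $x\in\mathcal{L}_\omega$). *)

theory Defs
  imports Main "HOL-Library.Stream"
begin

text \<open>
  Finite words are lists and right infinite words are streams, so for a non-empty word \<open>w\<close> the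
  infinite power \<open>w\<^sup>\<omega>\<close> is \<^term>\<open>cycle w\<close>. A total order \<open>\<preceq>\<close> on the infinite words is a relation
  \<open>r\<close> with \<^prop>\<open>linear_order r\<close>: \<open>x \<preceq> y\<close> is \<^prop>\<open>(x, y) \<in> r\<close>, and \<open>x \<prec> y\<close>, i.e. \<open>x \<preceq> y\<close> and
  \<open>x \<noteq> y\<close>, is \<^prop>\<open>(x, y) \<in> r - Id\<close>.
\<close>

text \<open>A proper suffix is non-empty, unlike a strict suffix in the theory \<open>Sublist\<close>.\<close>

definition proper_suffix :: "'a list \<Rightarrow> 'a list \<Rightarrow> bool" where
  "proper_suffix v w \<longleftrightarrow> v \<noteq> [] \<and> (\<exists>u. u \<noteq> [] \<and> w = u @ v)"

definition proper_suffix_inf :: "'a stream \<Rightarrow> 'a stream \<Rightarrow> bool" where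
  "proper_suffix_inf y x \<longleftrightarrow> (\<exists>u. u \<noteq> [] \<and> x = u @- y)"

definition omega_Lyndon :: "'a stream rel \<Rightarrow> 'a list \<Rightarrow> bool" where
  "omega_Lyndon r w \<longleftrightarrow>
     w \<noteq> [] \<and> (\<forall>v. proper_suffix v w \<longrightarrow> (cycle w, cycle v) \<in> r - Id)"

definition omega_Lyndon_inf :: "'a stream rel \<Rightarrow> 'a stream \<Rightarrow> bool" where
  "omega_Lyndon_inf r x \<longleftrightarrow> (\<forall>y. proper_suffix_inf y x \<longrightarrow> (x, y) \<in> r - Id)"

text \<open>
  \<open>Finite_Fact [l\<^sub>1, \<dots>, l\<^sub>m] y\<close> stands for \<open>l\<^sub>1 \<cdots> l\<^sub>m y\<close>, with \<open>k = m + 1\<close> factors, the last one being the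
  infinite word \<open>y\<close>; \<open>Infinite_Fact ls\<close> stands for \<open>l\<^sub>1 l\<^sub>2 l\<^sub>3 \<cdots>\<close>.
\<close>

datatype 'a factorisation =
    Finite_Fact "'a list list" "'a stream"
  | Infinite_Fact "'a list stream"

text \<open>
  \<^const>\<open>flat\<close> is the infinite product of the factors only when none of them is empty, which
  \<^const>\<open>omega_Lyndon\<close> guarantees.
\<close>

fun omega_Lyndon_factorisation ::
    "'a stream rel \<Rightarrow> 'a stream \<Rightarrow> 'a factorisation \<Rightarrow> bool" where
  "omega_Lyndon_factorisation r x (Finite_Fact ls y) \<longleftrightarrow>
     x = concat ls @- y \<and>
     (\<forall>l \<in> set ls. omega_Lyndon r l) \<and> omega_Lyndon_inf r y \<and>
     successively (\<lambda>l l'. (cycle l', cycle l) \<in> r) ls \<and>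
     (ls \<noteq> [] \<longrightarrow> (y, cycle (last ls)) \<in> r - Id)"
| "omega_Lyndon_factorisation r x (Infinite_Fact ls) \<longleftrightarrow>
     x = flat ls \<and>
     (\<forall>i. omega_Lyndon r (ls !! i)) \<and>
     (\<forall>i. (cycle (ls !! Suc i), cycle (ls !! i)) \<in> r)"

end

theory Submission
  imports Defs "HOL-Library.Sublist"
begin

text \<open>
  The hypothesis on the order says that two words with different prefixes of length \<open>n\<close> compare
  as these prefixes do, so all cylinders are intervals; no relation between \<open>x \<preceq> y\<close> and
  \<open>ux \<preceq> uy\<close> is implied. If \<open>s\<^sup>\<omega>\<close> differs from \<open>c\<close> and all of \<open>l\<^sub>1\<^sup>\<omega>, l\<^sub>2\<^sup>\<omega>, \<dots>\<close> lie
  between \<open>c\<close> and \<open>s\<^sup>\<omega>\<close>, then these powers share the longest common prefix of \<open>c\<close> and \<open>s\<^sup>\<omega>\<close>,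
  hence so does \<open>l\<^sub>1l\<^sub>2\<cdots>\<close>, and \<open>sl\<^sub>1l\<^sub>2\<cdots>\<close> follows \<open>s\<^sup>\<omega>\<close> one letter further than \<open>c\<close> does.
  So \<open>sl\<^sub>1l\<^sub>2\<cdots>\<close> and \<open>s\<^sup>\<omega>\<close> lie on the same side of \<open>c\<close>.

  For a finite word it follows that the last factor is the shortest suffix with the least
  infinite power, which gives existence and uniqueness for finite words. For an infinite word \<open>x\<close>,
  let \<open>c\<close> be the infimum of its suffixes. Any factorisation of \<open>x\<close> has a cut at the first occurrence
  of each sufficiently long prefix of \<open>c\<close> or, if \<open>c\<close> is itself a suffix of \<open>x\<close>, of \<open>c\<close>. Between
  these cuts the factorisation is that of a finite word. If \<open>c\<close> is a suffix of \<open>x\<close>, then it is the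
  last factor, or it is \<open>u\<^sup>\<omega>\<close> for a Lyndon word \<open>u\<close> which is then repeated for ever.
\<close>

section \<open>Streams with a common prefix\<close>

lemma stake_eq_mono: "stake n x = stake n y \<Longrightarrow> m \<le> n \<Longrightarrow> stake m x = stake m y"
  by (metis take_stake min.absorb1)

lemma stream_eqI: "(\<And>n. stake n x = stake n y) \<Longrightarrow> x = y"
  by (metis stream_smap_nats lessI stake_nth ext)

lemma stake_shift_eq:
  "stake m y = stake m z \<Longrightarrow> n \<le> length l + m \<Longrightarrow> stake n (l @- y) = stake n (l @- z)"
  by (auto simp: stake_shift intro: stake_eq_mono)

text \<open>Since \<open>cycle l = l @- cycle l\<close> and \<open>l\<close> has a letter,
  prepending \<open>l\<close> extends any agreement with \<open>cycle l\<close> by at least one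
  place.\<close>

lemma stake_Suc_shift_cycle:
  assumes "l \<noteq> []" "stake n z = stake n (cycle l)"
  shows "stake (Suc n) (l @- z) = stake (Suc n) (cycle l)"
proof -
  have "stake (Suc n) (l @- z) = stake (Suc n) (l @- cycle l)"
    using assms by (intro stake_shift_eq[where m = n]) (auto simp: Suc_le_eq)
  then show ?thesis by (metis cycle_decomp[OF assms(1)])
qed

lemma shift_fixpoint:
  assumes "u \<noteq> []" "z = u @- z"
  shows "z = cycle u"
proof (rule stream_eqI)
  show "stake n z = stake n (cycle u)" for n
    by (induction n) (use assms in \<open>auto dest!: stake_Suc_shift_cycle simp del: stake.simps(2)\<close>)
qed

lemma stake_concat_shift:
  assumes "\<And>l. l \<in> set ls \<Longrightarrow> l \<noteq> [] \<and> stake n (cycle l) = stake n c"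
    and "stake n z = stake n c"
  shows "stake n (concat ls @- z) = stake n c"
  using assms
proof (induction ls)
  case (Cons l ls)
  then have "stake n (concat ls @- z) = stake n (cycle l)" by simp
  then have "stake (Suc n) (l @- (concat ls @- z)) = stake (Suc n) (cycle l)"
    using Cons.prems by (intro stake_Suc_shift_cycle) auto
  then show ?case using Cons.prems(1)[of l] by (simp add: stake_Suc del: stake.simps(2))
qed simp

text \<open>The power is its own tail, so the induction is on the number of agreeing letters:
  \<open>m\<close> of them pass from the whole power back through all factors but the first, which
  then gains one more.\<close>

lemma stake_cycle_concat:
  assumes "\<And>l. l \<in> set ls \<Longrightarrow> l \<noteq> [] \<and> stake n (cycle l) = stake n c" and "ls \<noteq> []"
  shows "stake n (cycle (concat ls)) = stake n c"
proof -
  have "stake m (cycle (concat ls)) = stake m c" if "m \<le> n" for m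
    using that
  proof (induction m)
    case (Suc m)
    obtain l ls' where ls: "ls = l # ls'" using assms(2) by (cases ls) auto
    let ?z = "concat ls' @- cycle (concat ls)"
    have eq: "l' \<noteq> [] \<and> stake k (cycle l') = stake k c" if "l' \<in> set ls" "k \<le> n" for l' k
      using assms(1)[OF that(1)] that(2) stake_eq_mono by blast
    have "stake m ?z = stake m c"
      using Suc eq[of _ m] ls by (intro stake_concat_shift) auto
    then have "stake (Suc m) (l @- ?z) = stake (Suc m) (cycle l)"
      using eq[of l m] ls Suc by (intro stake_Suc_shift_cycle) auto
    moreover have "concat ls \<noteq> []" using eq[of l m] ls Suc.prems by auto
    then have "cycle (concat ls) = l @- ?z"
      using cycle_decomp ls by (metis concat.simps(2) shift_append)
    ultimately show ?case using eq[of l "Suc m"] ls Suc.prems by (simp del: stake.simps(2))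
  qed simp
  then show ?thesis by simp
qed

text \<open>There is no last factor to start from, so agreement is proved letter by letter, for all
  tails of the sequence at once.\<close>

lemma stake_flat:
  assumes "\<And>i. ls !! i \<noteq> [] \<and> stake n (cycle (ls !! i)) = stake n c"
  shows "stake n (flat ls) = stake n c"
proof -
  have "stake m (flat (sdrop i ls)) = stake m c" if "m \<le> n" for m i
    using that
  proof (induction m arbitrary: i)
    case (Suc m)
    have eq: "ls !! i \<noteq> [] \<and> stake k (cycle (ls !! i)) = stake k c" if "k \<le> n" for k
      using assms that stake_eq_mono by blast
    have "sdrop i ls = ls !! i ## sdrop (Suc i) ls"
      by (metis id_stake_snth_sdrop shift_left_inj stake_sdrop)
    then have "flat (sdrop i ls) = ls !! i @- flat (sdrop (Suc i) ls)"
      using eq[of m] Suc by (metis Suc_leD flat_Stream)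
    moreover have "stake (Suc m) (ls !! i @- flat (sdrop (Suc i) ls)) =
        stake (Suc m) (cycle (ls !! i))"
      using eq[of m] Suc.IH[of "Suc i"] Suc.prems by (intro stake_Suc_shift_cycle) auto
    ultimately show ?case using eq[OF Suc.prems] by (simp del: stake.simps(2))
  qed simp
  from this[of n 0] show ?thesis by simp
qed

lemma flat_split:
  assumes "\<And>i. ls !! i \<noteq> []"
  shows "flat ls = concat (stake k ls) @- flat (sdrop k ls)"
proof (induction k)
  case (Suc k)
  have "sdrop k ls = ls !! k ## sdrop (Suc k) ls"
    by (metis id_stake_snth_sdrop shift_left_inj stake_sdrop)
  then have "flat (sdrop k ls) = ls !! k @- flat (sdrop (Suc k) ls)"
    using assms by (metis flat_Stream)
  then show ?case using Suc by (simp add: stake_Suc del: stake.simps(2))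
qed simp

lemma length_concat_stake:
  assumes "\<And>i. ls !! i \<noteq> []"
  shows "k \<le> length (concat (stake k ls))"
proof (induction k)
  case (Suc k)
  then show ?case using assms[of k]
    by (cases "ls !! k") (auto simp: stake_Suc simp del: stake.simps(2))
qed simp

lemma suffix_concat:
  assumes "concat ls = p @ v" "v \<noteq> []"
  shows "\<exists>ls1 l' s ls2. ls = ls1 @ (l' @ s) # ls2 \<and> s \<noteq> [] \<and> v = s @ concat ls2"
  using assms
proof (induction ls arbitrary: p)
  case (Cons l ls)
  show ?case
  proof (cases "length p < length l")
    case True
    then have "take (length p) l = p" "v = drop (length p) l @ concat ls" "drop (length p) l \<noteq> []"
      using Cons.prems by (simp_all add: append_eq_append_conv_if)
    then show ?thesis by (metis append_Nil append_take_drop_id)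
  next
    case False
    then have "concat ls = drop (length l) p @ v"
      using Cons.prems by (auto simp: append_eq_append_conv_if)
    from Cons.IH[OF this Cons.prems(2)] show ?thesis by (metis append_Cons)
  qed
qed simp

text \<open>In the prefix metric, \<open>z\<close> is at least as close to \<open>c\<close> as \<open>b\<close> is.\<close>

definition near :: "'a stream \<Rightarrow> 'a stream \<Rightarrow> 'a stream \<Rightarrow> bool" where
  "near b c z \<longleftrightarrow> (\<forall>n. stake n b = stake n c \<longrightarrow> stake n z = stake n c)"

lemma near_self: "near b c c"
  by (simp add: near_def)

lemma near_concat_shift:
  assumes "\<And>l. l \<in> set ls \<Longrightarrow> l \<noteq> [] \<and> near b c (cycle l)" and "near b c z"
  shows "near b c (concat ls @- z)"
  using assms stake_concat_shift[of ls _ c z] unfolding near_def by blast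

lemma near_cycle_concat:
  assumes "\<And>l. l \<in> set ls \<Longrightarrow> l \<noteq> [] \<and> near b c (cycle l)" and "ls \<noteq> []"
  shows "near b c (cycle (concat ls))"
  using assms stake_cycle_concat[of ls _ c] unfolding near_def by blast

lemma near_flat:
  assumes "\<And>i. ls !! i \<noteq> [] \<and> near b c (cycle (ls !! i))"
  shows "near b c (flat ls)"
  using assms stake_flat[of ls _ c] unfolding near_def by blast

lemma flat_eq_cycle:
  assumes "\<And>i. ls !! i \<noteq> [] \<and> cycle (ls !! i) = c"
  shows "flat ls = c"
  using assms stake_flat[of ls _ c] by (intro stream_eqI) auto

lemma first_difference:
  assumes "x \<noteq> y"
  obtains n where "stake n x = stake n y" "\<And>m. n < m \<Longrightarrow> stake m x \<noteq> stake m y"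
proof -
  have "\<exists>m. stake m x \<noteq> stake m y" using assms stream_eqI by blast
  then have "\<exists>n. stake n x = stake n y \<and> stake (Suc n) x \<noteq> stake (Suc n) y"
    using nat_induct[of "\<lambda>n. stake n x = stake n y"] by (metis stake.simps(1))
  then show ?thesis using that stake_eq_mono by (metis Suc_leI)
qed

text \<open>
  Since \<open>cycle s = s @- cycle s\<close>, prepending the non-empty \<open>s\<close> to a word near \<open>c\<close> gains at least one
  letter of agreement with \<open>cycle s\<close>; hence \<open>s @- z\<close> branches off from \<open>c\<close> exactly where
  \<open>cycle s\<close> does.
\<close>

lemma shift_near:
  assumes "s \<noteq> []" "cycle s \<noteq> c" "near (cycle s) c z"
  obtains n where "stake n (s @- z) = stake n (cycle s)" "stake n (cycle s) \<noteq> stake n c"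
    "\<And>m. stake m (cycle s) \<noteq> stake m c \<Longrightarrow> stake m (s @- z) \<noteq> stake m c"
proof -
  obtain n where n: "stake n (cycle s) = stake n c"
    "\<And>m. n < m \<Longrightarrow> stake m (cycle s) \<noteq> stake m c"
    using first_difference[OF assms(2)] by blast
  have eq: "stake (Suc n) (s @- z) = stake (Suc n) (cycle s)"
    using assms n(1) by (intro stake_Suc_shift_cycle) (auto simp: near_def)
  have "stake m (s @- z) \<noteq> stake m c" if "stake m (cycle s) \<noteq> stake m c" for m
  proof -
    have "Suc n \<le> m" using that n(1) stake_eq_mono not_less_eq_eq by blast
    then show ?thesis using eq n(2)[of "Suc n"] stake_eq_mono by (metis lessI)
  qed
  then show ?thesis using that[of "Suc n"] eq n(2) by blast
qed

lemma shift_eq_same_length: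
  assumes "length xs = length ys" "xs @- y = ys @- z"
  shows "xs = ys"
  using assms by (induction xs ys rule: list_induct2) auto

text \<open>Entry \<open>i\<close> of the limit is read off a member of the chain longer than
  \<open>i\<close>. In the existence proof this glues the factorisations of longer and longer
  prefixes.\<close>

lemma stream_of_prefix_chain:
  fixes L :: "nat \<Rightarrow> 'a list"
  assumes "\<And>m n. m \<le> n \<Longrightarrow> prefix (L m) (L n)" and "\<And>N. \<exists>n. N \<le> length (L n)"
  obtains ls where "\<And>n. stake (length (L n)) ls = L n"
proof -
  have "\<forall>i. \<exists>n. Suc i \<le> length (L n)" using assms(2) by blast
  then obtain f where f: "\<And>i. Suc i \<le> length (L (f i))" by metis
  define ls where "ls = smap (\<lambda>i. L (f i) ! i) nats"
  have "stake (length (L n)) ls = L n" for n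
  proof (rule nth_equalityI)
    fix i assume "i < length (stake (length (L n)) ls)"
    then have i: "i < length (L n)" "i < length (L (f i))" using f[of i] by simp_all
    have "L (f i) ! i = L n ! i"
      using assms(1)[of n "f i"] assms(1)[of "f i" n] i nat_le_linear[of n "f i"]
      by (auto simp: prefix_def nth_append)
    then show "stake (length (L n)) ls ! i = L n ! i" using i(1) by (simp add: ls_def)
  qed simp
  then show ?thesis by (rule that)
qed

lemma flat_shift:
  "[] \<notin> set ls \<Longrightarrow> flat (ls @- ms) = concat ls @- flat ms"
  by (induction ls) auto

lemma stake_sconst: "stake n (sconst u) = replicate n u"
  by (simp add: id_def[symmetric] map_replicate_const)

section \<open>Lexicographic-like orders\<close>

locale word_order =
  fixes r :: "('a :: finite) stream rel"
  assumes linear_order: "linear_order r"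
    and cycle_less: "\<And>u v x y. u \<noteq> [] \<Longrightarrow> length u = length v \<Longrightarrow>
      (cycle u, cycle v) \<in> r - Id \<Longrightarrow> (u @- x, v @- y) \<in> r - Id"
begin

abbreviation le (infix "\<preceq>" 50) where "x \<preceq> y \<equiv> (x, y) \<in> r"
abbreviation less (infix "\<prec>" 50) where "x \<prec> y \<equiv> (x, y) \<in> r - Id"

sublocale ord: linorder le less
proof -
  have r: "refl r" "trans r" "antisym r" "total r"
    using linear_order by (auto simp: linear_order_on_def partial_order_on_def preorder_on_def)
  show "class.linorder le less"
  proof
    show "x \<preceq> y \<or> y \<preceq> x" for x y
      using r(1,4) by (cases "x = y") (auto simp: total_on_def dest: reflD)
  qed (use r in \<open>auto dest: reflD antisymD transD\<close>)
qed

text \<open>The hypothesis on the order compares powers of the two prefixes. These powers differ,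
  and in the wrong order they would force \<open>y \<prec> x\<close>; so they are in the right
  order, and this decides the comparison for all tails.\<close>

lemma prefix_less:
  assumes "x \<prec> y" "stake n x \<noteq> stake n y" "stake n x' = stake n x" "stake n y' = stake n y"
  shows "x' \<prec> y'"
proof -
  let ?u = "stake n x" and ?v = "stake n y"
  have ne: "?u \<noteq> []" "?v \<noteq> []" using assms(2) by (auto intro: gr0I)
  have "cycle ?u \<noteq> cycle ?v" using assms(2) ne by (metis length_stake stake_cycle_eq)
  moreover have False if "cycle ?v \<prec> cycle ?u"
    using cycle_less[OF ne(2) _ that, of "sdrop n y" "sdrop n x"] assms(1)
    by (simp only: stake_sdrop length_stake) (meson ord.less_asym)
  ultimately have "cycle ?u \<prec> cycle ?v" using ord.neq_iff by blast
  from cycle_less[OF ne(1) _ this, of "sdrop n x'" "sdrop n y'"] show ?thesis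
    using assms(3,4) by (metis length_stake stake_sdrop)
qed

text \<open>A word outside a cylinder lies on the same side of all its members.\<close>

lemma stake_convex:
  assumes "x \<preceq> z" "z \<preceq> y" "stake n x = stake n y"
  shows "stake n z = stake n x"
proof (rule ccontr)
  assume ne: "stake n z \<noteq> stake n x"
  then have "x \<prec> z" using assms(1) by auto
  from prefix_less[OF this ne[symmetric] assms(3)[symmetric] refl] have "y \<prec> z" .
  then show False using assms(2) by (meson ord.leD)
qed

lemma near_between: "c \<preceq> z \<Longrightarrow> z \<preceq> b \<Longrightarrow> near b c z"
  unfolding near_def by (metis stake_convex)

lemma near_mono: "near b' c z \<Longrightarrow> c \<preceq> b' \<Longrightarrow> b' \<preceq> b \<Longrightarrow> near b c z"
  unfolding near_def by (metis stake_convex)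

lemma shift_greater:
  assumes "s \<noteq> []" "c \<prec> cycle s" "near (cycle s) c z"
  shows "c \<prec> s @- z"
proof -
  obtain n where "stake n (s @- z) = stake n (cycle s)" "stake n (cycle s) \<noteq> stake n c"
    using shift_near[of s c z] assms by auto
  then show ?thesis using prefix_less[OF assms(2), of n c] by metis
qed

lemma shift_less:
  assumes "s \<noteq> []" "cycle s \<prec> c" "near (cycle s) c z"
  shows "s @- z \<prec> c"
proof -
  obtain n where "stake n (s @- z) = stake n (cycle s)" "stake n (cycle s) \<noteq> stake n c"
    using shift_near[of s c z] assms by auto
  then show ?thesis using prefix_less[OF assms(2), of n _ c] by metis
qed

section \<open>Nonincreasing products of Lyndon words\<close>

text \<open>Any two factors are compared, not only neighbours, so that bounds by the first or last
  factor are immediate. By transitivity this is equivalent.\<close>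

definition lyndon_product :: "'a list list \<Rightarrow> bool" where
  "lyndon_product ls \<longleftrightarrow>
     (\<forall>l \<in> set ls. omega_Lyndon r l) \<and> sorted_wrt (\<lambda>l l'. cycle l' \<preceq> cycle l) ls"

lemma lyndon_product_iff_successively:
  "lyndon_product ls \<longleftrightarrow>
     (\<forall>l \<in> set ls. omega_Lyndon r l) \<and> successively (\<lambda>l l'. cycle l' \<preceq> cycle l) ls"
proof -
  have "transp (\<lambda>l l'. cycle l' \<preceq> cycle l)" by (auto intro!: transpI intro: ord.order_trans)
  then show ?thesis by (simp add: lyndon_product_def successively_conv_sorted_wrt)
qed

lemma lyndon_product_append:
  "lyndon_product (ls @ ms) \<longleftrightarrow> lyndon_product ls \<and> lyndon_product ms \<and>
     (ls = [] \<or> ms = [] \<or> cycle (hd ms) \<preceq> cycle (last ls))"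
  by (auto simp: lyndon_product_iff_successively successively_append_iff)

lemma lyndon_product_singleton: "lyndon_product [u] \<longleftrightarrow> omega_Lyndon r u"
  by (simp add: lyndon_product_def)

lemma lyndon_product_replicate: "omega_Lyndon r u \<Longrightarrow> lyndon_product (replicate n u)"
  by (auto simp: lyndon_product_def sorted_wrt_iff_nth_less)

lemma lyndon_product_nonempty: "lyndon_product ls \<Longrightarrow> l \<in> set ls \<Longrightarrow> l \<noteq> []"
  by (auto simp: lyndon_product_def omega_Lyndon_def)

lemma lyndon_product_last:
  "lyndon_product ls \<Longrightarrow> l \<in> set ls \<Longrightarrow> cycle (last ls) \<preceq> cycle l"
  by (cases ls rule: rev_cases) (auto simp: lyndon_product_def sorted_wrt_append)

lemma lyndon_product_hd:
  "lyndon_product ls \<Longrightarrow> l \<in> set ls \<Longrightarrow> cycle l \<preceq> cycle (hd ls)"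
  by (cases ls) (auto simp: lyndon_product_def)

section \<open>Suffixes of a product and uniqueness for finite words\<close>

lemma lyndon_suffix_le:
  assumes "omega_Lyndon r (p @ s)" "s \<noteq> []"
  shows "cycle (p @ s) \<preceq> cycle s"
proof (cases "p = []")
  case False
  then show ?thesis using assms unfolding omega_Lyndon_def proper_suffix_def by blast
qed simp

text \<open>The suffix starts in some factor \<open>l' @ s\<close>. Being Lyndon, this factor has a
  power at most \<open>cycle s\<close>, so \<open>cycle s\<close> bounds all later powers. The
  strict inequality is the case where \<open>s\<close> is a proper suffix of the last
  factor.\<close>

lemma lyndon_product_suffix:
  assumes "lyndon_product ls" "concat ls = p @ v" "v \<noteq> []"
  obtains s ms where "v = s @ concat ms" "s \<noteq> []" "set ms \<subseteq> set ls"
    "\<And>l. l \<in> set ms \<Longrightarrow> cycle l \<preceq> cycle s" "cycle (last ls) \<preceq> cycle s"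
    "ms = [] \<Longrightarrow> length s < length (last ls) \<Longrightarrow> cycle (last ls) \<prec> cycle s"
    "ms \<noteq> [] \<Longrightarrow> last ms = last ls"
proof -
  obtain ls1 l' s ms where ls: "ls = ls1 @ (l' @ s) # ms" "s \<noteq> []" "v = s @ concat ms"
    using suffix_concat[OF assms(2,3)] by blast
  have lyn: "omega_Lyndon r (l' @ s)" using assms(1) ls(1) by (simp add: lyndon_product_def)
  have le: "cycle (l' @ s) \<preceq> cycle s" using lyndon_suffix_le[OF lyn ls(2)] .
  have "cycle l \<preceq> cycle s" if "l \<in> set ms" for l
  proof -
    have "cycle l \<preceq> cycle (l' @ s)"
      using assms(1) ls(1) that by (auto simp: lyndon_product_def sorted_wrt_append)
    then show ?thesis using le ord.order_trans by blast
  qed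
  moreover have "cycle (last ls) \<preceq> cycle s"
    using lyndon_product_last[OF assms(1), of "l' @ s"] le ls(1) ord.order_trans by auto
  moreover have "ms = [] \<Longrightarrow> length s < length (last ls) \<Longrightarrow> cycle (last ls) \<prec> cycle s"
    using lyn ls unfolding omega_Lyndon_def proper_suffix_def by auto
  ultimately show ?thesis using that[of s ms] ls by auto
qed

text \<open>The powers of \<open>ls\<close> and the word \<open>y\<close> are near \<open>c\<close>,
  hence so is \<open>concat ls @- y\<close>, and prepending \<open>s\<close> leads to the side of
  \<open>cycle s\<close>. If \<open>c = cycle s\<close>, nearness makes
  \<open>concat ls @- y\<close> equal to \<open>c\<close>.\<close>

lemma product_ge:
  assumes "s \<noteq> []" "c \<preceq> cycle s" "\<And>l. l \<in> set ls \<Longrightarrow> l \<noteq> [] \<and> c \<preceq> cycle l \<and> cycle l \<preceq> cycle s"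
    and "near (cycle s) c y"
  shows "c \<preceq> s @- concat ls @- y"
    and "stake n (cycle s) \<noteq> stake n c \<Longrightarrow> stake n (s @- concat ls @- y) \<noteq> stake n c"
proof -
  have near: "near (cycle s) c (concat ls @- y)"
    using assms near_between by (intro near_concat_shift) auto
  show "c \<preceq> s @- concat ls @- y"
  proof (cases "c = cycle s")
    case True
    then have "concat ls @- y = c" using near by (intro stream_eqI) (simp add: near_def)
    then show ?thesis using True cycle_decomp[OF assms(1)] by simp
  next
    case False
    then show ?thesis using shift_greater[OF assms(1) _ near] assms(2) by blast
  qed
  show "stake n (s @- concat ls @- y) \<noteq> stake n c" if "stake n (cycle s) \<noteq> stake n c"
    using shift_near[OF assms(1) _ near] that by metis
qed

text \<open>
  Every suffix of \<open>concat ls @- y\<close> starting before \<open>y\<close> branches off from \<open>c\<close> no later than the power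
  of the last factor does. So the position of \<open>y\<close> is a first occurrence, which does not depend on
  the factorisation.
\<close>

lemma earlier_suffix:
  assumes "lyndon_product ls" "k < length (concat ls)" "c \<preceq> cycle (last ls)"
    and "near (cycle (last ls)) c y"
  shows "c \<preceq> sdrop k (concat ls @- y)"
    and "stake n (cycle (last ls)) \<noteq> stake n c \<Longrightarrow> stake n (sdrop k (concat ls @- y)) \<noteq> stake n c"
    and "cycle (last ls) \<noteq> c \<Longrightarrow> sdrop k (concat ls @- y) \<noteq> c"
proof -
  have ne: "drop k (concat ls) \<noteq> []" using assms(2) by simp
  obtain s ms where s: "drop k (concat ls) = s @ concat ms" "s \<noteq> []" "set ms \<subseteq> set ls"
    "\<And>l. l \<in> set ms \<Longrightarrow> cycle l \<preceq> cycle s" "cycle (last ls) \<preceq> cycle s"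
    using lyndon_product_suffix[OF assms(1) append_take_drop_id[symmetric] ne] by metis
  have eq: "sdrop k (concat ls @- y) = s @- concat ms @- y"
    using s(1) assms(2) by (simp add: sdrop_shift)
  have cs: "c \<preceq> cycle s" using assms(3) s(5) ord.order_trans by blast
  have near: "near (cycle s) c y" using near_mono[OF assms(4,3) s(5)] .
  have ms: "l \<noteq> [] \<and> c \<preceq> cycle l \<and> cycle l \<preceq> cycle s" if "l \<in> set ms" for l
    using that s(3,4) lyndon_product_nonempty[OF assms(1)] lyndon_product_last[OF assms(1)]
      assms(3) ord.order_trans by blast
  show "c \<preceq> sdrop k (concat ls @- y)"
    using product_ge(1)[OF s(2) cs ms near] eq by simp
  show diff: "stake n (sdrop k (concat ls @- y)) \<noteq> stake n c"
    if "stake n (cycle (last ls)) \<noteq> stake n c" for n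
  proof -
    have "stake n (cycle s) \<noteq> stake n c" using s(5) assms(3) stake_convex that by metis
    then show ?thesis using product_ge(2)[OF s(2) cs ms near] eq by simp
  qed
  show "cycle (last ls) \<noteq> c \<Longrightarrow> sdrop k (concat ls @- y) \<noteq> c"
    using diff stream_eqI by metis
qed

text \<open>Here \<open>v\<close> is any suffix, not only one at a cut: the two parts make the last
  factor the shortest suffix with the least power. A shorter \<open>v\<close> lies inside the last
  factor, where the Lyndon condition is strict.\<close>

lemma last_factor_minimal:
  assumes "lyndon_product ls" "concat ls = p @ v" "v \<noteq> []"
  shows "cycle (last ls) \<preceq> cycle v"
    and "length v < length (last ls) \<Longrightarrow> cycle (last ls) \<prec> cycle v"
proof -
  let ?u = "cycle (last ls)"
  obtain s ms where s: "v = s @ concat ms" "s \<noteq> []" "set ms \<subseteq> set ls"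
    "\<And>l. l \<in> set ms \<Longrightarrow> cycle l \<preceq> cycle s" "?u \<preceq> cycle s"
    "ms = [] \<Longrightarrow> length s < length (last ls) \<Longrightarrow> ?u \<prec> cycle s"
    "ms \<noteq> [] \<Longrightarrow> last ms = last ls"
    using lyndon_product_suffix[OF assms] by metis
  have ms: "l \<noteq> [] \<and> ?u \<preceq> cycle l \<and> cycle l \<preceq> cycle s" if "l \<in> set (s # ms)" for l
    using that s lyndon_product_nonempty[OF assms(1)] lyndon_product_last[OF assms(1)] by auto
  \<comment> \<open>As \<open>v = s @ concat ms\<close>, the word \<open>cycle v\<close> is this
    product followed by \<open>cycle v\<close> itself, which thus serves as the tail
    \<open>y\<close> in \<open>product_ge\<close>.\<close>
  have "near (cycle s) ?u (cycle (concat (s # ms)))"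
    using ms near_between by (intro near_cycle_concat) auto
  from product_ge(1)[OF s(2,5) _ this, of ms]
  have "?u \<preceq> v @- cycle v" using ms s(1) by simp
  then show "?u \<preceq> cycle v" using cycle_decomp[OF assms(3)] by metis
  assume len: "length v < length (last ls)"
  have "ms = []"
  proof (rule ccontr)
    assume "ms \<noteq> []"
    then have "last ls \<in> set ms" using s(7) last_in_set by metis
    then obtain ms1 ms2 where "ms = ms1 @ last ls # ms2" by (meson split_list)
    then have "length (concat ms) = length (concat ms1) + length (last ls) + length (concat ms2)"
      by (metis add.assoc concat.simps(2) concat_append length_append)
    then show False using len s(1) by simp
  qed
  then show "?u \<prec> cycle v" using s(1,6) len by simp
qed

text \<open>Both last factors are suffixes of the same word. Minimality applied both ways gives them
  equal powers, and neither can be shorter; they are removed and the induction continues.\<close>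

lemma lyndon_product_unique:
  assumes "lyndon_product ls" "lyndon_product ms" "concat ls = concat ms"
  shows "ls = ms"
  using assms
proof (induction ls arbitrary: ms rule: rev_induct)
  case Nil
  then show ?case using lyndon_product_nonempty by (cases ms) auto
next
  case (snoc l ls)
  have "ms \<noteq> []" using snoc.prems lyndon_product_nonempty[OF snoc.prems(1), of l] by auto
  then obtain m ms' where ms: "ms = ms' @ [m]" by (metis rev_exhaust)
  have ne: "l \<noteq> []" "m \<noteq> []"
    using lyndon_product_nonempty snoc.prems(1,2) ms by auto
  have cat: "concat (ls @ [l]) = concat ms' @ m" "concat ms = concat ls @ l"
    using snoc.prems(3) ms by auto
  note l = last_factor_minimal[OF snoc.prems(1) cat(1) ne(2), simplified]
  note m = last_factor_minimal[OF snoc.prems(2) cat(2) ne(1), unfolded ms, simplified]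
  have "cycle l = cycle m" using l(1) m(1) ord.order_antisym by blast
  then have "length l = length m" using l(2) m(2) by (auto intro: linorder_cases)
  then have "l = m" "concat ls = concat ms'" using snoc.prems(3) ms by auto
  then show ?case using snoc.IH[of ms'] snoc.prems(1,2) ms by (auto simp: lyndon_product_append)
qed

section \<open>Uniqueness\<close>

text \<open>The order is not assumed complete. But over a finite alphabet there are finitely many
  prefixes of each length, so one cylinder is least among those meeting \<open>X\<close>. The least
  prefixes extend one another, and \<open>c\<close>, which need not belong to \<open>X\<close>, is
  their limit.\<close>

lemma closure_infimum:
  assumes "X \<noteq> {}"
  obtains c where "\<And>v. v \<in> X \<Longrightarrow> c \<preceq> v" "\<And>n. \<exists>v\<in>X. stake n v = stake n c"
proof -
  have "\<exists>a\<in>X. \<forall>v\<in>X. stake n v = stake n a \<or> a \<prec> v" for n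
  proof -
    have "finite (stake n ` X)"
      by (rule finite_subset[OF _ finite_lists_length_eq[OF finite_UNIV, of n]]) auto
    from finite_subset_image[OF this order_refl]
    obtain R where R: "R \<subseteq> X" "finite R" "stake n ` X = stake n ` R" by blast
    have "R \<noteq> {}" using R(3) assms by (metis image_is_empty)
    from ord.finite_has_minimal[OF R(2) this]
    obtain a where a: "a \<in> R" "\<And>b. b \<in> R \<Longrightarrow> b \<preceq> a \<Longrightarrow> a = b" by blast
    have "stake n v = stake n a \<or> a \<prec> v" if "v \<in> X" for v
    proof -
      have "stake n v \<in> stake n ` R" unfolding R(3)[symmetric] using that by (rule imageI)
      then obtain b where b: "b \<in> R" "stake n v = stake n b" by (rule imageE)
      have "a = b \<or> a \<prec> b" using a(2)[OF b(1)] ord.linear[of a b] by blast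
      then show ?thesis using prefix_less[of a b n a v] b(2) by metis
    qed
    then show ?thesis using a(1) R(1) by blast
  qed
  then obtain a where a: "\<And>n. a n \<in> X" "\<And>n v. v \<in> X \<Longrightarrow> stake n v = stake n (a n) \<or> a n \<prec> v"
    by metis
  have coherent: "stake m (a n) = stake m (a m)" if "m \<le> n" for m n
  proof (rule ccontr)
    assume ne: "stake m (a n) \<noteq> stake m (a m)"
    then have "stake n (a m) \<noteq> stake n (a n)" using that stake_eq_mono by metis
    then have "a n \<prec> a m" "a m \<prec> a n" using a ne by metis+
    then show False by (meson ord.less_asym)
  qed
  define c where "c = smap (\<lambda>m. a (Suc m) !! m) nats"
  have c: "stake n c = stake n (a n)" for n
  proof (rule nth_equalityI)
    fix m assume "m < length (stake n c)"
    then have "stake n c ! m = stake (Suc m) (a (Suc m)) ! m"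
      "stake n (a n) ! m = stake (Suc m) (a n) ! m"
      by (simp_all add: c_def del: stake.simps(2))
    then show "stake n c ! m = stake n (a n) ! m"
      using coherent[of "Suc m" n] \<open>m < length (stake n c)\<close> by (metis Suc_leI length_stake)
  qed simp
  show ?thesis
  proof (rule that)
    show "\<exists>v\<in>X. stake n v = stake n c" for n using a(1) c by metis
    fix v assume v: "v \<in> X"
    show "c \<preceq> v"
    proof (cases "c = v")
      case False
      then obtain n where n: "stake n c \<noteq> stake n v" using stream_eqI by blast
      then have "a n \<prec> v" using a(2)[OF v, of n] c by metis
      then show ?thesis using prefix_less[of "a n" v n c v] n c by (metis DiffD1)
    qed simp
  qed
qed

text \<open>The second clause puts \<open>c\<close> in the closure of the suffixes without making it
  a suffix.\<close>

definition suffix_infimum :: "'a stream \<Rightarrow> 'a stream \<Rightarrow> bool" where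
  "suffix_infimum x c \<longleftrightarrow>
     (\<forall>k. c \<preceq> sdrop k x) \<and> (\<forall>n. \<exists>k. stake n (sdrop k x) = stake n c)"

lemma suffix_infimum_exists: "\<exists>c. suffix_infimum x c"
proof (rule closure_infimum)
  show "range (\<lambda>k. sdrop k x) \<noteq> {}" by simp
  show ?thesis if "\<And>v. v \<in> range (\<lambda>k. sdrop k x) \<Longrightarrow> c \<preceq> v"
    "\<And>n. \<exists>v\<in>range (\<lambda>k. sdrop k x). stake n v = stake n c" for c
    using that unfolding suffix_infimum_def by (intro exI[of _ c]) auto
qed

text \<open>If \<open>c \<prec> d\<close>, some suffix shares with \<open>c\<close> a prefix on
  which \<open>c\<close> and \<open>d\<close> differ. This suffix is below \<open>d\<close>, so
  \<open>d\<close> is no lower bound.\<close>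

lemma suffix_infimum_unique:
  assumes "suffix_infimum x c" "suffix_infimum x d"
  shows "c = d"
proof (rule ccontr)
  have no: False if inf: "suffix_infimum x c" "suffix_infimum x d" "c \<prec> d" for c d
  proof -
    obtain n where n: "stake n c \<noteq> stake n d" using inf(3) stream_eqI by blast
    obtain k where "stake n (sdrop k x) = stake n c" using inf(1) suffix_infimum_def by metis
    then have "sdrop k x \<prec> d" using prefix_less[OF inf(3) n] by blast
    then show False using inf(2) unfolding suffix_infimum_def by (meson ord.leD)
  qed
  assume "c \<noteq> d"
  then show False using no assms ord.neq_iff by blast
qed

text \<open>Suffixes starting before \<open>y\<close> exceed it by \<open>earlier_suffix\<close>
  with \<open>c = y\<close>, later ones because \<open>y\<close> is Lyndon. So \<open>y\<close> and
  the place where it starts are determined by \<open>x\<close>.\<close>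

lemma finite_factorisation_suffixes:
  assumes "omega_Lyndon_factorisation r x (Finite_Fact ls y)"
  shows "lyndon_product ls" "x = concat ls @- y" "suffix_infimum x y"
    and "sdrop k x = y \<longleftrightarrow> k = length (concat ls)"
proof -
  show prod: "lyndon_product ls" and x: "x = concat ls @- y"
    using assms by (auto simp: lyndon_product_iff_successively)
  let ?n = "length (concat ls)"
  have lt: "y \<preceq> sdrop k x \<and> y \<noteq> sdrop k x" if "k < ?n" for k
  proof -
    have "ls \<noteq> []" using that by auto
    then have "y \<preceq> cycle (last ls)" "cycle (last ls) \<noteq> y" using assms by auto
    then show ?thesis using earlier_suffix[OF prod that _ near_self] x by metis
  qed
  have gt: "y \<prec> sdrop k x" if "k > ?n" for k
  proof -
    have "y = stake (k - ?n) y @- sdrop (k - ?n) y" by (simp add: stake_sdrop)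
    then have "proper_suffix_inf (sdrop (k - ?n) y) y"
      using that unfolding proper_suffix_inf_def
      by (metis stake_invert_Nil zero_less_diff less_irrefl)
    moreover have "sdrop k x = sdrop (k - ?n) y" using that x by (simp add: sdrop_shift)
    ultimately show ?thesis using assms by (simp add: omega_Lyndon_inf_def)
  qed
  have eq: "sdrop ?n x = y" using x by (simp add: sdrop_shift)
  show "sdrop k x = y \<longleftrightarrow> k = ?n" using lt gt eq by (metis nat_neq_iff DiffD2 IdI)
  have "y \<preceq> sdrop k x" for k using lt[of k] gt[of k] eq by (cases k ?n rule: linorder_cases) auto
  then show "suffix_infimum x y" using eq by (auto simp: suffix_infimum_def)
qed

section \<open>Infinite nonincreasing products of Lyndon words\<close>

definition lyndon_stream :: "'a list stream \<Rightarrow> bool" where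
  "lyndon_stream ls \<longleftrightarrow> (\<forall>k. lyndon_product (stake k ls))"

lemma lyndon_streamD:
  assumes "lyndon_stream ls"
  shows "omega_Lyndon r (ls !! i)" "ls !! i \<noteq> []" "i \<le> j \<Longrightarrow> cycle (ls !! j) \<preceq> cycle (ls !! i)"
proof -
  have prod: "lyndon_product (stake k ls)" for k using assms by (simp add: lyndon_stream_def)
  have "ls !! i \<in> set (stake (Suc i) ls)" by (simp add: stake_Suc del: stake.simps(2))
  then show "omega_Lyndon r (ls !! i)" using prod[of "Suc i"]
    by (simp add: lyndon_product_def del: stake.simps(2))
  then show "ls !! i \<noteq> []" by (simp add: omega_Lyndon_def)
  assume "i \<le> j"
  then have "ls !! i \<in> set (stake (Suc j) ls)"
    by (metis le_imp_less_Suc length_stake nth_mem stake_nth)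
  then show "cycle (ls !! j) \<preceq> cycle (ls !! i)"
    using lyndon_product_last[OF prod, of "ls !! i" "Suc j"]
    by (simp add: stake_Suc del: stake.simps(2))
qed

lemma infinite_factorisation_iff:
  "omega_Lyndon_factorisation r x (Infinite_Fact ls) \<longleftrightarrow> x = flat ls \<and> lyndon_stream ls"
proof -
  have "lyndon_product (stake k ls)"
    if "\<forall>i. omega_Lyndon r (ls !! i)" "\<forall>i. cycle (ls !! Suc i) \<preceq> cycle (ls !! i)" for k
  proof (induction k)
    case (Suc k)
    have "cycle (ls !! k) \<preceq> cycle (last (stake k ls))" if "stake k ls \<noteq> []"
      using that \<open>\<forall>i. cycle (ls !! Suc i) \<preceq> cycle (ls !! i)\<close>
      by (cases k) (simp_all add: stake_Suc del: stake.simps(2))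
    then show ?case using Suc that(1)
      by (auto simp: stake_Suc lyndon_product_append lyndon_product_singleton simp del: stake.simps(2))
  qed (simp add: lyndon_product_def)
  moreover have "cycle (ls !! Suc i) \<preceq> cycle (ls !! i)" if "lyndon_stream ls" for i
    using lyndon_streamD(3)[OF that, of i "Suc i"] by simp
  ultimately show ?thesis
    unfolding omega_Lyndon_factorisation.simps using lyndon_streamD(1) lyndon_stream_def by blast
qed

text \<open>From factor \<open>k\<close> on, all powers lie between \<open>c\<close> and
  \<open>cycle (ls !! k)\<close>, so they keep the common prefix.\<close>

lemma lyndon_stream_tail:
  assumes "lyndon_stream ls" "\<And>i. c \<preceq> cycle (ls !! i)" "stake n (cycle (ls !! k)) = stake n c"
  shows "stake n (flat (sdrop k ls)) = stake n c"
proof (rule stake_flat)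
  fix i
  have "cycle (ls !! (k + i)) \<preceq> cycle (ls !! k)" using lyndon_streamD(3)[OF assms(1)] by simp
  then have "stake n (cycle (ls !! (k + i))) = stake n c"
    using stake_convex[OF assms(2)] assms(3) by metis
  then show "sdrop k ls !! i \<noteq> [] \<and> stake n (cycle (sdrop k ls !! i)) = stake n c"
    using lyndon_streamD(2)[OF assms(1)] by (simp add: sdrop_snth)
qed

lemma lyndon_stream_tail_eq:
  assumes "lyndon_stream ls" "\<And>i. c \<preceq> cycle (ls !! i)" "cycle (ls !! k) = c"
  shows "flat (sdrop k ls) = c"
  using lyndon_stream_tail[OF assms(1,2)] assms(3) by (intro stream_eqI) simp

text \<open>The factors after \<open>k\<close> have powers between \<open>c\<close> and
  \<open>cycle (ls !! k)\<close>, so their product is near \<open>c\<close> and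
  \<open>earlier_suffix\<close> applies to the first \<open>Suc k\<close> factors.\<close>

lemma lyndon_stream_suffix:
  assumes "lyndon_stream ls" "\<And>i. c \<preceq> cycle (ls !! i)"
    and "q < length (concat (stake (Suc k) ls))"
  shows "c \<preceq> sdrop q (flat ls)"
    and "stake n (cycle (ls !! k)) \<noteq> stake n c \<Longrightarrow> stake n (sdrop q (flat ls)) \<noteq> stake n c"
    and "cycle (ls !! k) \<noteq> c \<Longrightarrow> sdrop q (flat ls) \<noteq> c"
proof -
  let ?y = "flat (sdrop (Suc k) ls)"
  have last: "last (stake (Suc k) ls) = ls !! k" by (simp add: stake_Suc del: stake.simps(2))
  have prod: "lyndon_product (stake (Suc k) ls)" using assms(1) by (simp only: lyndon_stream_def)
  have near: "near (cycle (ls !! k)) c ?y"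
  proof (rule near_flat)
    fix i
    show "sdrop (Suc k) ls !! i \<noteq> [] \<and> near (cycle (ls !! k)) c (cycle (sdrop (Suc k) ls !! i))"
      unfolding sdrop_snth
      by (intro conjI near_between lyndon_streamD(2,3)[OF assms(1)] assms(2)) simp
  qed
  have x: "flat ls = concat (stake (Suc k) ls) @- ?y"
    using flat_split lyndon_streamD(2)[OF assms(1)] by blast
  note * = earlier_suffix[OF prod assms(3), unfolded last, OF assms(2) near, folded x]
  show "c \<preceq> sdrop q (flat ls)"
    "stake n (cycle (ls !! k)) \<noteq> stake n c \<Longrightarrow> stake n (sdrop q (flat ls)) \<noteq> stake n c"
    "cycle (ls !! k) \<noteq> c \<Longrightarrow> sdrop q (flat ls) \<noteq> c"
    using * by blast+
qed

lemma less_length_concat_stake: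
  "lyndon_stream ls \<Longrightarrow> q < length (concat (stake (Suc q) ls))"
  using length_concat_stake[of ls "Suc q"] lyndon_streamD(2) by (metis Suc_le_lessD)

lemma sdrop_flat:
  assumes "lyndon_stream ls"
  shows "sdrop (length (concat (stake k ls))) (flat ls) = flat (sdrop k ls)"
  using flat_split[of ls k] lyndon_streamD(2)[OF assms] by (simp add: sdrop_shift)

text \<open>The infimum \<open>d\<close> of the powers is also that of the suffixes: it is a lower
  bound of them, and once a power has a given prefix of \<open>d\<close>, so does the tail starting
  at that factor. Uniqueness of the infimum gives \<open>d = c\<close>.\<close>

lemma lyndon_stream_infimum:
  assumes "lyndon_stream ls" "suffix_infimum (flat ls) c"
  shows "c \<preceq> cycle (ls !! i)" and "\<exists>i. stake n (cycle (ls !! i)) = stake n c"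
proof -
  let ?X = "range (\<lambda>i. cycle (ls !! i))"
  obtain d where X: "\<And>v. v \<in> ?X \<Longrightarrow> d \<preceq> v" "\<And>n. \<exists>v\<in>?X. stake n v = stake n d"
    by (rule closure_infimum[of ?X]) auto
  have d: "d \<preceq> cycle (ls !! i)" "\<exists>i. stake n (cycle (ls !! i)) = stake n d" for i n
    using X(1) X(2)[of n] by auto
  have "suffix_infimum (flat ls) d"
    unfolding suffix_infimum_def
  proof (intro conjI allI)
    show "d \<preceq> sdrop k (flat ls)" for k
      using lyndon_stream_suffix(1)[OF assms(1) d(1) less_length_concat_stake[OF assms(1)]] .
    show "\<exists>k. stake n (sdrop k (flat ls)) = stake n d" for n
      using d(2) lyndon_stream_tail[OF assms(1) d(1)] sdrop_flat[OF assms(1)] by metis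
  qed
  then have "d = c" using suffix_infimum_unique assms(2) by blast
  then show "c \<preceq> cycle (ls !! i)" "\<exists>i. stake n (cycle (ls !! i)) = stake n c"
    using d by blast+
qed

text \<open>The set \<open>M\<close> allows for the two uses: a single prefix of \<open>c\<close>, and the whole of \<open>c\<close>.\<close>

lemma first_cut:
  assumes "lyndon_stream ls" "suffix_infimum (flat ls) c"
    and "\<exists>i. \<forall>n\<in>M. stake n (cycle (ls !! i)) = stake n c"
  defines "k \<equiv> LEAST i. \<forall>n\<in>M. stake n (cycle (ls !! i)) = stake n c"
  shows "\<forall>n\<in>M. stake n (cycle (ls !! k)) = stake n c"
    and "length (concat (stake k ls)) = (LEAST q. \<forall>n\<in>M. stake n (sdrop q (flat ls)) = stake n c)"
proof -
  note c = lyndon_stream_infimum(1)[OF assms(1,2)]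
  show k: "\<forall>n\<in>M. stake n (cycle (ls !! k)) = stake n c"
    unfolding k_def using assms(3) by (rule LeastI_ex)
  have "\<forall>n\<in>M. stake n (sdrop (length (concat (stake k ls))) (flat ls)) = stake n c"
    using k lyndon_stream_tail[OF assms(1) c] sdrop_flat[OF assms(1)] by simp
  moreover have "length (concat (stake k ls)) \<le> q"
    if q: "\<forall>n\<in>M. stake n (sdrop q (flat ls)) = stake n c" for q
  proof (rule ccontr)
    assume less: "\<not> length (concat (stake k ls)) \<le> q"
    \<comment> \<open>By minimality of \<open>k\<close>, the power of the factor just before the cut
      differs from \<open>c\<close> at some length in \<open>M\<close>; then so does every suffix
      starting before the end of this factor.\<close>
    then obtain j where j: "k = Suc j" by (cases k) auto
    then have "j < k" by simp
    then have "\<not> (\<forall>n\<in>M. stake n (cycle (ls !! j)) = stake n c)"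
      unfolding k_def by (rule not_less_Least)
    then obtain n where n: "n \<in> M" "stake n (cycle (ls !! j)) \<noteq> stake n c" by blast
    have "q < length (concat (stake (Suc j) ls))" using less unfolding j by (simp only: not_le)
    from lyndon_stream_suffix(2)[OF assms(1) c this n(2)] show False using q n(1) by blast
  qed
  ultimately show "length (concat (stake k ls)) =
      (LEAST q. \<forall>n\<in>M. stake n (sdrop q (flat ls)) = stake n c)"
    by (intro Least_equality[symmetric]) auto
qed

text \<open>The position of the first cut depends only on \<open>flat ls\<close>, \<open>c\<close>
  and \<open>M\<close>. So both products are cut at the same place, and uniqueness for finite words
  applies to what precedes it.\<close>

lemma common_cut:
  assumes "lyndon_stream ls" "lyndon_stream ms" "flat ls = flat ms" "suffix_infimum (flat ls) c"
    and "\<exists>i. \<forall>n\<in>M. stake n (cycle (ls !! i)) = stake n c"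
    and "\<exists>i. \<forall>n\<in>M. stake n (cycle (ms !! i)) = stake n c"
  obtains k where "stake k ls = stake k ms" "\<forall>n\<in>M. stake n (cycle (ls !! k)) = stake n c"
    "\<forall>n\<in>M. stake n (cycle (ms !! k)) = stake n c"
proof -
  define k where "k = (LEAST i. \<forall>n\<in>M. stake n (cycle (ls !! i)) = stake n c)"
  define k' where "k' = (LEAST i. \<forall>n\<in>M. stake n (cycle (ms !! i)) = stake n c)"
  note k = first_cut[OF assms(1,4,5), folded k_def]
  note k' = first_cut[OF assms(2) assms(4)[unfolded assms(3)] assms(6), folded k'_def assms(3)]
  have len: "length (concat (stake k ls)) = length (concat (stake k' ms))" using k(2) k'(2) by simp
  have "flat ls = concat (stake k ls) @- flat (sdrop k ls)"
    "flat ls = concat (stake k' ms) @- flat (sdrop k' ms)"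
    using flat_split lyndon_streamD(2) assms(1-3) by metis+
  then have "concat (stake k ls) = concat (stake k' ms)"
    using len by (metis shift_eq_same_length)
  then have eq: "stake k ls = stake k' ms"
    using lyndon_product_unique assms(1,2) lyndon_stream_def by blast
  then have "k = k'" by (metis length_stake)
  then show ?thesis using that[of k] eq k(1) k'(1) by blast
qed

text \<open>Repeating \<open>l\<close> \<open>length m\<close> times and \<open>m\<close>
  \<open>length l\<close> times gives two Lyndon products of the same word.\<close>

lemma omega_Lyndon_cycle_inj:
  assumes "omega_Lyndon r l" "omega_Lyndon r m" "cycle l = cycle m"
  shows "l = m"
proof -
  have ne: "l \<noteq> []" "m \<noteq> []" using assms by (auto simp: omega_Lyndon_def)
  let ?ls = "replicate (length m) l" and ?ms = "replicate (length l) m"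
  have "concat ?ls = stake (length l * length m) (cycle l)"
    "concat ?ms = stake (length l * length m) (cycle m)"
    using ne by simp_all
  then have "?ls = ?ms" using lyndon_product_unique lyndon_product_replicate assms by metis
  then show ?thesis using ne by (metis hd_replicate length_0_conv replicate_empty)
qed

lemma infinite_factorisation_unique:
  assumes "lyndon_stream ls" "lyndon_stream ms" "flat ls = flat ms"
  shows "ls = ms"
proof -
  obtain c where c: "suffix_infimum (flat ls) c" using suffix_infimum_exists by blast
  note ls = lyndon_stream_infimum[OF assms(1) c] lyndon_streamD[OF assms(1)]
  note ms = lyndon_stream_infimum[OF assms(2) c[unfolded assms(3)]] lyndon_streamD[OF assms(2)]
  have "ls !! N = ms !! N" for N
  proof (cases "\<exists>q. sdrop q (flat ls) = c")
    case True
    \<comment> \<open>Factor number \<open>q\<close> ends after position \<open>q\<close>, so if the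
      suffix at \<open>q\<close> is \<open>c\<close>, the power of this factor is \<open>c\<close>.
      From a common cut on, all powers are then \<open>c\<close>, which determines the
      factors.\<close>
    then have "\<exists>i. cycle (ls !! i) = c" "\<exists>i. cycle (ms !! i) = c"
      using lyndon_stream_suffix(3)[OF assms(1) ls(1) less_length_concat_stake[OF assms(1)]]
        lyndon_stream_suffix(3)[OF assms(2) ms(1) less_length_concat_stake[OF assms(2)]] assms(3)
      by metis+
    then have "\<exists>i. \<forall>n\<in>UNIV. stake n (cycle (ls !! i)) = stake n c"
      "\<exists>i. \<forall>n\<in>UNIV. stake n (cycle (ms !! i)) = stake n c" by metis+
    from common_cut[OF assms c this]
    obtain k where k: "stake k ls = stake k ms" "cycle (ls !! k) = c" "cycle (ms !! k) = c"
      by (metis UNIV_I stream_eqI)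
    show ?thesis
    proof (cases "N < k")
      case True
      then show ?thesis using k(1) stake_nth by metis
    next
      case False
      then have "cycle (ls !! N) = c" "cycle (ms !! N) = c"
        using ls(1,5) ms(1,5) k(2,3) by (metis not_le_imp_less ord.order_antisym linorder_le_cases)+
      then show ?thesis using omega_Lyndon_cycle_inj ls(3) ms(3) by metis
    qed
  next
    case False
    \<comment> \<open>Both powers leave \<open>c\<close> within \<open>max n1 n2\<close> letters, so
      a common cut for the prefix of that length comes after factor \<open>N\<close>.\<close>
    then have "cycle (ls !! N) \<noteq> c" "cycle (ms !! N) \<noteq> c"
      using lyndon_stream_tail_eq[OF assms(1) ls(1)] lyndon_stream_tail_eq[OF assms(2) ms(1)]
        sdrop_flat assms by metis+
    then obtain n1 n2 where "stake n1 (cycle (ls !! N)) \<noteq> stake n1 c"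
      "stake n2 (cycle (ms !! N)) \<noteq> stake n2 c"
      using stream_eqI by metis
    then have n: "stake (max n1 n2) (cycle (ls !! N)) \<noteq> stake (max n1 n2) c"
      using stake_eq_mono by (metis max.cobounded1)
    have "\<exists>i. \<forall>n\<in>{max n1 n2}. stake n (cycle (ls !! i)) = stake n c"
      "\<exists>i. \<forall>n\<in>{max n1 n2}. stake n (cycle (ms !! i)) = stake n c" using ls(2) ms(2) by auto
    from common_cut[OF assms c this]
    obtain k where k: "stake k ls = stake k ms"
      "stake (max n1 n2) (cycle (ls !! k)) = stake (max n1 n2) c"
      by blast
    have "N < k"
      using n k(2) stake_convex[OF ls(1) ls(5)] by (metis not_le_imp_less)
    then show ?thesis using k(1) stake_nth by metis
  qed
  then show ?thesis by (metis stream_smap_nats ext)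
qed

lemma factorisation_unique:
  assumes "omega_Lyndon_factorisation r x F" "omega_Lyndon_factorisation r x G"
  shows "F = G"
proof -
  \<comment> \<open>In the infinite factorisation two consecutive factors would have the power
    \<open>y\<close>, so \<open>y\<close> would start at two positions of \<open>x\<close>; the
    finite one allows only one.\<close>
  have no: False if "omega_Lyndon_factorisation r x (Finite_Fact ls y)"
    "omega_Lyndon_factorisation r x (Infinite_Fact ms)" for ls y ms
  proof -
    note fin = finite_factorisation_suffixes[OF that(1)]
    have inf: "x = flat ms" "lyndon_stream ms"
      using that(2) by (simp_all only: infinite_factorisation_iff)
    note c = lyndon_stream_infimum(1)[OF inf(2) fin(3)[unfolded inf(1)]]
    obtain i where i: "cycle (ms !! i) = y"
      using lyndon_stream_suffix(3)[OF inf(2) c less_length_concat_stake[OF inf(2)]] fin(4) inf(1)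
      by metis
    then have "cycle (ms !! Suc i) = y"
      using c lyndon_streamD(3)[OF inf(2), of i "Suc i"] ord.order_antisym by fastforce
    then have "length (concat (stake i ms)) = length (concat (stake (Suc i) ms))"
      using lyndon_stream_tail_eq[OF inf(2) c] i sdrop_flat[OF inf(2)] fin(4) inf(1) by metis
    then show False using lyndon_streamD(2)[OF inf(2), of i]
      by (simp add: stake_Suc del: stake.simps(2))
  qed
  have fin: "ls = ms \<and> y = z" if "omega_Lyndon_factorisation r x (Finite_Fact ls y)"
    "omega_Lyndon_factorisation r x (Finite_Fact ms z)" for ls y ms z
  proof -
    note ls = finite_factorisation_suffixes[OF that(1)]
      and ms = finite_factorisation_suffixes[OF that(2)]
    have "y = z" using suffix_infimum_unique ls(3) ms(3) by blast
    then have "length (concat ls) = length (concat ms)" using ls(4) ms(4) by metis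
    then have "concat ls = concat ms"
      using ls(2) ms(2) by (metis shift_eq_same_length)
    then show ?thesis using lyndon_product_unique ls(1) ms(1) \<open>y = z\<close> by blast
  qed
  have inf: "ls = ms" if "omega_Lyndon_factorisation r x (Infinite_Fact ls)"
    "omega_Lyndon_factorisation r x (Infinite_Fact ms)" for ls ms
    using that infinite_factorisation_unique unfolding infinite_factorisation_iff by metis
  show ?thesis
  proof (cases F)
    case F: (Finite_Fact ls y)
    show ?thesis
    proof (cases G)
      case (Finite_Fact ms z)
      then show ?thesis using fin assms F by blast
    next
      case (Infinite_Fact ms)
      then show ?thesis using no assms F by blast
    qed
  next
    case F: (Infinite_Fact ls)
    show ?thesis
    proof (cases G)
      case (Finite_Fact ms z)
      then show ?thesis using no assms F by blast
    next
      case (Infinite_Fact ms)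
      then show ?thesis using inf assms F by blast
    qed
  qed
qed

section \<open>Existence\<close>

text \<open>The shortest suffix with the least power is Lyndon: its proper suffixes have powers that
  are no smaller and, by minimal length, different.\<close>

lemma minimal_suffix:
  assumes "w \<noteq> []"
  obtains p v where "w = p @ v" "v \<noteq> []" "omega_Lyndon r v"
    "\<forall>q t. w = q @ t \<longrightarrow> t \<noteq> [] \<longrightarrow> cycle v \<preceq> cycle t"
proof -
  let ?V = "{v. v \<noteq> [] \<and> suffix v w}"
  have "finite (cycle ` ?V)"
    by (rule finite_imageI, rule finite_subset[of _ "set (suffixes w)"]) auto
  moreover have "cycle ` ?V \<noteq> {}" using assms by auto
  ultimately have "\<exists>c \<in> cycle ` ?V. \<forall>d \<in> cycle ` ?V. d \<preceq> c \<longrightarrow> c = d"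
    by (rule ord.finite_has_minimal)
  then obtain t where t: "t \<in> ?V" "\<And>d. d \<in> cycle ` ?V \<Longrightarrow> d \<preceq> cycle t \<Longrightarrow> cycle t = d" by blast
  have min: "cycle t \<preceq> cycle u" if "u \<in> ?V" for u
    using t(2)[of "cycle u"] that ord.linear[of "cycle t" "cycle u"] by auto
  define P where "P v \<longleftrightarrow> v \<in> ?V \<and> cycle v = cycle t" for v
  have "P t" using t(1) by (simp add: P_def)
  from ex_has_least_nat[of P, OF this, of length]
  obtain v where v: "P v" "\<And>u. P u \<Longrightarrow> length v \<le> length u" by blast
  have "omega_Lyndon r v"
    unfolding omega_Lyndon_def
  proof (intro conjI allI impI)
    show "v \<noteq> []" using v(1) by (simp add: P_def)
    fix u assume "proper_suffix u v"
    then obtain z where u: "u \<noteq> []" "z \<noteq> []" "v = z @ u" by (auto simp: proper_suffix_def)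
    then have uV: "u \<in> ?V" using v(1) by (auto simp: P_def suffix_def)
    have "\<not> P u" using v(2)[of u] u by auto
    then show "cycle v \<prec> cycle u" using uV min[OF uV] v(1) by (auto simp: P_def)
  qed
  moreover obtain p where "w = p @ v" using v(1) by (auto simp: P_def suffix_def)
  moreover have "cycle v \<preceq> cycle u" if "w = q @ u" "u \<noteq> []" for q u
    using min[of u] that v(1) by (auto simp: P_def suffix_def)
  ultimately show ?thesis using that[of p v] v(1) by (simp add: P_def)
qed

text \<open>The suffix from \<open>minimal_suffix\<close> becomes the last factor and the rest is
  factored by induction. Only the order of the last two powers needs proof.\<close>

lemma lyndon_product_exists: "\<exists>ls. lyndon_product ls \<and> concat ls = w"
proof (induction w rule: length_induct)
  case (1 w)
  show ?case
  proof (cases "w = []")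
    case True
    then show ?thesis by (intro exI[of _ "[]"]) (simp add: lyndon_product_def)
  next
    case False
    obtain p v where v: "w = p @ v" "v \<noteq> []" "omega_Lyndon r v"
      "\<forall>q t. w = q @ t \<longrightarrow> t \<noteq> [] \<longrightarrow> cycle v \<preceq> cycle t"
      by (rule minimal_suffix[OF False])
    then have "length p < length w" by simp
    then obtain ls where ls: "lyndon_product ls" "concat ls = p" using 1 by blast
    have "cycle v \<preceq> cycle (last ls)" if nonempty: "ls \<noteq> []"
    proof (rule ccontr)
      assume "\<not> cycle v \<preceq> cycle (last ls)"
      then have less: "cycle (last ls) \<prec> cycle v" by (meson ord.not_le)
      obtain qs s where qs: "ls = qs @ [s]" using nonempty by (cases ls rule: rev_cases) auto
      have ne: "s \<noteq> []" using lyndon_product_nonempty[OF ls(1)] qs by simp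
      \<comment> \<open>The word \<open>v @- cycle (s @ v)\<close> is at least as near to
        \<open>cycle v\<close> as \<open>cycle s\<close> is, so prepending \<open>s\<close> gives a
        word below \<open>cycle v\<close>. That word is the power of the suffix \<open>s @ v\<close>
        of \<open>w\<close>, against the minimality of \<open>v\<close>.\<close>
      have "near (cycle s) (cycle v) (cycle (concat [s, v]))"
        by (rule near_cycle_concat) (use ne v(2) in \<open>auto simp: near_def\<close>)
      then have "near (cycle s) (cycle v) (concat [v] @- cycle (s @ v))"
        using v(2) by (intro near_concat_shift) (auto simp: near_def)
      then have "s @- v @- cycle (s @ v) \<prec> cycle v"
        using shift_less[OF ne, of "cycle v"] less qs by simp
      moreover have "cycle (s @ v) = s @- v @- cycle (s @ v)"
        using cycle_decomp[of "s @ v"] ne by (metis Nil_is_append_conv shift_append)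
      moreover have "cycle v \<preceq> cycle (s @ v)"
        using v(1) v(4)[rule_format, of "concat qs" "s @ v"] ls(2) qs ne by simp
      ultimately show False by (metis ord.leD)
    qed
    then have "lyndon_product (ls @ [v])"
      using ls(1) v(3) by (auto simp: lyndon_product_append lyndon_product_singleton)
    then show ?thesis using ls(2) v(1) by (intro exI[of _ "ls @ [v]"]) simp
  qed
qed

text \<open>If \<open>c\<close> is not Lyndon, it equals one of its proper suffixes, since none is
  smaller, and so is periodic. Its shortest period \<open>u\<close> is Lyndon and is repeated for
  ever.\<close>

lemma factorisation_exists_attained:
  assumes c: "suffix_infimum x c" and k: "sdrop k x = c"
  shows "\<exists>F. omega_Lyndon_factorisation r x F"
proof -
  obtain ls where ls: "lyndon_product ls" "concat ls = stake k x"
    using lyndon_product_exists by blast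
  have x: "x = concat ls @- c" using ls(2) k stake_sdrop by metis
  have suffix: "c \<preceq> v" if "x = p @- v" for p v
    using c that sdrop_shift[of "length p" p v] by (simp add: suffix_infimum_def)
      (metis shift.simps(1))
  \<comment> \<open>If \<open>cycle s \<prec> c\<close>, then the suffix \<open>s @- c\<close> of
    \<open>x\<close> would be below \<open>c\<close>.\<close>
  have last: "last ls \<noteq> [] \<and> c \<preceq> cycle (last ls)" if ne: "ls \<noteq> []"
  proof -
    obtain qs s where qs: "ls = qs @ [s]" using ne by (cases ls rule: rev_cases) auto
    have s: "s \<noteq> []" using lyndon_product_nonempty[OF ls(1)] qs by simp
    have "c \<preceq> s @- c" using suffix[of "concat qs"] x qs by simp
    moreover from this have "c \<preceq> cycle s"
      using shift_less[OF s _ near_self, of c] by (meson ord.leD ord.leI)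
    ultimately show ?thesis using s qs by simp
  qed
  show ?thesis
  proof (cases "omega_Lyndon_inf r c")
    case True
    have "cycle (last ls) \<noteq> c" if "ls \<noteq> []"
    proof
      assume "cycle (last ls) = c"
      then have "c = last ls @- c" using cycle_decomp last[OF that] by metis
      then have "proper_suffix_inf c c" using last[OF that] unfolding proper_suffix_inf_def by blast
      then show False using True by (auto simp: omega_Lyndon_inf_def)
    qed
    then have "omega_Lyndon_factorisation r x (Finite_Fact ls c)"
      using ls(1) x last True by (auto simp: lyndon_product_iff_successively)
    then show ?thesis by blast
  next
    case False
    then obtain t y where t: "t \<noteq> []" "c = t @- y" "\<not> c \<prec> y"
      by (auto simp: omega_Lyndon_inf_def proper_suffix_inf_def)
    have "c \<preceq> y" using suffix[of "concat ls @ t" y] x t(2) by simp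
    then have "t \<noteq> [] \<and> c = t @- c" using t by auto
    from ex_has_least_nat[of "\<lambda>t. t \<noteq> [] \<and> c = t @- c", OF this, of length]
    obtain u where u: "u \<noteq> []" "c = u @- c"
      and least: "\<And>t. t \<noteq> [] \<Longrightarrow> c = t @- c \<Longrightarrow> length u \<le> length t" by blast
    have cu: "cycle u = c" using shift_fixpoint[OF u] by simp
    have lyn: "omega_Lyndon r u"
      unfolding omega_Lyndon_def
    proof (intro conjI allI impI)
      fix v assume "proper_suffix v u"
      then obtain z where v: "v \<noteq> []" "z \<noteq> []" "u = z @ v" by (auto simp: proper_suffix_def)
      \<comment> \<open>A \<open>v\<close> with power \<open>c\<close> would be a shorter period;
        one with a smaller power would put the suffix \<open>v @- c\<close> of \<open>x\<close>
        below \<open>c\<close>.\<close>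
      have "cycle v \<noteq> c"
        using least[of v] v cycle_decomp[of v] by fastforce
      moreover have "c = z @- v @- c" using u(2) v(3) by simp
      then have "c \<preceq> v @- c" using suffix[of "concat ls @ z"] x by (metis shift_append)
      then have "\<not> cycle v \<prec> c" using shift_less[OF v(1) _ near_self] by (meson ord.leD)
      ultimately show "cycle u \<prec> cycle v" using cu by (metis ord.neq_iff)
    qed (rule u(1))
    have "lyndon_product (stake n (ls @- sconst u))" for n
    proof -
      have "lyndon_product (ls @ replicate n u)"
        using ls(1) lyndon_product_replicate[OF lyn, of n] last cu
        by (cases n) (auto simp: lyndon_product_append)
      then have "lyndon_product (take n (ls @ replicate n u))"
        by (metis append_take_drop_id lyndon_product_append)
      then show ?thesis by (simp add: stake_shift stake_sconst del: stake_siterate)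
    qed
    then have "lyndon_stream (ls @- sconst u)" by (simp add: lyndon_stream_def)
    moreover have "flat (sconst u) = c" by (rule flat_eq_cycle) (use u(1) cu in auto)
    then have "flat (ls @- sconst u) = x"
      using flat_shift[of ls] lyndon_product_nonempty[OF ls(1)] x by auto
    ultimately show ?thesis using infinite_factorisation_iff by blast
  qed
qed

text \<open>
  The hypotheses say that \<open>z\<close>, but not \<open>s @- z\<close>, begins with the prefix of length \<open>n\<close> of the
  infimum \<open>c\<close>.
\<close>

lemma factor_before_first_occurrence:
  assumes "s \<noteq> []" "c \<preceq> s @- z" "stake n z = stake n c" "stake n (s @- z) \<noteq> stake n c"
  shows "stake n (cycle s) \<noteq> stake n c" "c \<preceq> cycle s" "near (cycle s) c z"
proof -
  show ne: "stake n (cycle s) \<noteq> stake n c"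
  proof
    assume *: "stake n (cycle s) = stake n c"
    then have "stake (Suc n) (s @- z) = stake (Suc n) (cycle s)"
      using assms by (intro stake_Suc_shift_cycle) auto
    then show False using * assms(4) stake_eq_mono by (metis le_add2 plus_1_eq_Suc)
  qed
  show near: "near (cycle s) c z"
    unfolding near_def
  proof (intro allI impI)
    fix i assume "stake i (cycle s) = stake i c"
    then have "i \<le> n" using ne stake_eq_mono by (metis nat_le_linear)
    then show "stake i z = stake i c" using assms(3) stake_eq_mono by blast
  qed
  show "c \<preceq> cycle s" using shift_less[OF assms(1) _ near] assms(2) by (meson ord.leD ord.leI)
qed

text \<open>The words before the first occurrences \<open>cut n\<close> of the prefixes of
  \<open>c\<close> are factored separately. Their factorisations extend one another and, as no
  suffix equals \<open>c\<close>, grow without bound; the limit is the factorisation of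
  \<open>x\<close>.\<close>

lemma factorisation_exists_not_attained:
  assumes c: "suffix_infimum x c" and not: "\<And>k. sdrop k x \<noteq> c"
  shows "\<exists>F. omega_Lyndon_factorisation r x F"
proof -
  define cut where "cut n = (LEAST k. stake n (sdrop k x) = stake n c)" for n
  have cut: "stake n (sdrop (cut n) x) = stake n c" for n
    unfolding cut_def by (rule LeastI_ex) (use c in \<open>simp add: suffix_infimum_def\<close>)
  have before: "stake n (sdrop k x) \<noteq> stake n c" if "k < cut n" for k n
    using that unfolding cut_def by (rule not_less_Least)
  have cut_mono: "cut m \<le> cut n" if "m \<le> n" for m n
    unfolding cut_def[of m] by (rule Least_le) (rule stake_eq_mono[OF cut that])
  have "\<forall>n. \<exists>ls. lyndon_product ls \<and> concat ls = stake (cut n) x"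
    using lyndon_product_exists by blast
  then obtain L where L: "\<And>n. lyndon_product (L n)" "\<And>n. concat (L n) = stake (cut n) x" by metis
  have last: "stake n (cycle s) \<noteq> stake n c" "c \<preceq> cycle s" "near (cycle s) c (sdrop (cut n) x)"
    if "stake (cut n) x = p @ s" "s \<noteq> []" for n p s
  proof -
    have "x = p @- s @- sdrop (cut n) x" using that(1) by (metis shift_append stake_sdrop)
    then have eq: "sdrop (length p) x = s @- sdrop (cut n) x"
      using sdrop_shift[of "length p" p "s @- sdrop (cut n) x"] by simp
    have "length p < cut n"
      using that by (metis length_append length_stake length_greater_0_conv less_add_same_cancel1)
    then have "stake n (s @- sdrop (cut n) x) \<noteq> stake n c" using before eq by metis
    moreover have "c \<preceq> s @- sdrop (cut n) x" using c eq unfolding suffix_infimum_def by metis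
    ultimately show "stake n (cycle s) \<noteq> stake n c" "c \<preceq> cycle s"
      "near (cycle s) c (sdrop (cut n) x)"
      using factor_before_first_occurrence[OF that(2)] cut by blast+
  qed
  have chain: "prefix (L m) (L n)" if "m \<le> n" for m n
  proof -
    let ?w = "stake (cut n - cut m) (sdrop (cut m) x)"
    obtain M where M: "lyndon_product M" "concat M = ?w" using lyndon_product_exists by blast
    have split: "stake (cut n) x = stake (cut m) x @ ?w" using cut_mono[OF that] by simp
    \<comment> \<open>Let \<open>s\<close> and \<open>h\<close> be the factors before and after the
      cut. \<open>cycle s\<close> leaves \<open>c\<close> within \<open>m\<close> letters;
      \<open>cycle h\<close> does not, or the suffix at \<open>cut m\<close> would too. Both are at
      least \<open>c\<close>, so convexity gives \<open>cycle h \<preceq> cycle s\<close>.\<close>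
    have "cycle (hd M) \<preceq> cycle (last (L m))" if ne: "L m \<noteq> []" "M \<noteq> []"
    proof -
      obtain A s where A: "L m = A @ [s]" using ne(1) by (cases "L m" rule: rev_cases) auto
      obtain B t where B: "M = B @ [t]" using ne(2) by (cases M rule: rev_cases) auto
      obtain h C where C: "M = h # C" using ne(2) by (cases M) auto
      have nonempty: "s \<noteq> []" "t \<noteq> []" "h \<noteq> []"
        using lyndon_product_nonempty L(1)[of m] M(1) A B C
        by (metis in_set_conv_decomp list.set_intros(1))+
      have "stake (cut m) x = concat A @ s" using L(2)[of m] A by simp
      note s = last[OF this nonempty(1)]
      have "stake (cut n) x = (stake (cut m) x @ concat B) @ t" using split M(2) B by simp
      note t = last[OF this nonempty(2)]
      have M_le: "cycle t \<preceq> cycle l \<and> cycle l \<preceq> cycle h" if "l \<in> set M" for l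
        using lyndon_product_last[OF M(1) that] lyndon_product_hd[OF M(1) that] B C
        by (metis last_snoc list.sel(1))
      have th: "cycle t \<preceq> cycle h" using M_le[of t] B by simp
      then have ch: "c \<preceq> cycle h" using t(2) ord.order_trans by blast
      have "l \<noteq> [] \<and> c \<preceq> cycle l \<and> cycle l \<preceq> cycle h" if "l \<in> set C" for l
        using that C M_le[of l] lyndon_product_nonempty[OF M(1)] t(2) ord.order_trans by auto
      note ge = product_ge(2)[OF nonempty(3) ch this near_mono[OF t(3,2) th], of C]
      have "sdrop (cut m) x = ?w @- sdrop (cut n) x"
        using stake_sdrop[of "cut n - cut m" "sdrop (cut m) x"] cut_mono[OF \<open>m \<le> n\<close>] by simp
      then have "sdrop (cut m) x = h @- concat C @- sdrop (cut n) x"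
        using M(2) C by (metis concat.simps(2) shift_append)
      then have h: "stake m (cycle h) = stake m c" using ge[of m] cut[of m] by metis
      have "cycle h \<preceq> cycle s"
      proof (rule ccontr)
        assume "\<not> cycle h \<preceq> cycle s"
        then have "cycle s \<preceq> cycle h" using ord.linear by blast
        then show False using stake_convex[OF s(2)] h s(1) by metis
      qed
      then show ?thesis using A C by simp
    qed
    then have "lyndon_product (L m @ M)" using L(1) M(1) by (auto simp: lyndon_product_append)
    moreover have "concat (L m @ M) = concat (L n)" using L(2) M(2) split by simp
    ultimately have "L n = L m @ M" using lyndon_product_unique L(1) by metis
    then show ?thesis by simp
  qed
  have unbounded: "\<exists>n. N \<le> length (L n)" for N
  proof (induction N)
    case (Suc N)
    then obtain n where n: "N \<le> length (L n)" by blast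
    obtain j where j: "stake j (sdrop (cut n) x) \<noteq> stake j c" using not stream_eqI by metis
    let ?m = "max j n"
    \<comment> \<open>The suffix at \<open>cut n\<close> leaves \<open>c\<close> within
      \<open>j\<close> letters, so a prefix of length \<open>?m\<close> occurs first elsewhere, and
      the list of factors has grown.\<close>
    have "cut ?m \<noteq> cut n" using j cut[of ?m] stake_eq_mono by (metis max.cobounded1)
    then have "L ?m \<noteq> L n" using L(2) by (metis length_stake)
    then have "length (L n) < length (L ?m)"
      using chain[of n ?m] by (metis max.cobounded2 prefix_length_less strict_prefix_def)
    then show ?case using n by (intro exI[of _ ?m]) simp
  qed simp
  obtain ls where ls: "\<And>n. stake (length (L n)) ls = L n"
    using stream_of_prefix_chain[OF chain unbounded] by blast
  have "lyndon_product (stake k ls)" for k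
  proof -
    obtain n where "k \<le> length (L n)" using unbounded by blast
    then have "stake k ls = take k (L n)" using ls[of n] take_stake by (metis min.absorb1)
    then show ?thesis using L(1) lyndon_product_append by (metis append_take_drop_id)
  qed
  then have stream: "lyndon_stream ls" by (simp add: lyndon_stream_def)
  have "stake k (flat ls) = stake k x" for k
  proof -
    obtain n where n: "k \<le> length (L n)" using unbounded by blast
    also have "\<dots> \<le> cut n"
      using length_concat_stake[of ls "length (L n)"] lyndon_streamD(2)[OF stream] ls L(2) by simp
    finally have "k \<le> cut n" .
    moreover have "flat ls = stake (cut n) x @- flat (sdrop (length (L n)) ls)"
      using flat_split[of ls "length (L n)"] lyndon_streamD(2)[OF stream] ls L(2) by simp
    ultimately show ?thesis by (simp add: stake_shift take_stake)
  qed
  then have "flat ls = x" by (rule stream_eqI)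
  then show ?thesis using stream infinite_factorisation_iff by blast
qed

lemma factorisation_exists: "\<exists>F. omega_Lyndon_factorisation r x F"
proof -
  obtain c where c: "suffix_infimum x c" using suffix_infimum_exists by blast
  show ?thesis
  proof (cases "\<exists>k. sdrop k x = c")
    case True
    then show ?thesis using factorisation_exists_attained[OF c] by blast
  next
    case False
    then show ?thesis by (intro factorisation_exists_not_attained[OF c]) simp
  qed
qed

end

theorem corollary2p17:
  fixes r :: "('a :: finite) stream rel"
  assumes "linear_order r"
    and "\<And>(n :: nat) u v x y. n \<ge> 1 \<Longrightarrow> length u = n \<Longrightarrow> length v = n \<Longrightarrow>
           (cycle u, cycle v) \<in> r - Id \<Longrightarrow> (u @- x, v @- y) \<in> r - Id"
  shows "\<forall>x. \<exists>!F. omega_Lyndon_factorisation r x F"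
proof -
  interpret word_order r
  proof
    fix u v :: "'a list" and x y
    assume u: "u \<noteq> []" "length u = length v" "(cycle u, cycle v) \<in> r - Id"
    have "length u \<ge> 1" using u(1) by (simp add: Suc_le_eq)
    then show "(u @- x, v @- y) \<in> r - Id" by (rule assms(2)[OF _ refl u(2)[symmetric] u(3)])
  qed (rule assms(1))
  show ?thesis
  proof (intro allI ex_ex1I)
    show "\<exists>F. omega_Lyndon_factorisation r x F" for x by (rule factorisation_exists)
  qed (rule factorisation_unique)
qed

end
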